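(* Let $K\subset\mathbb{R}^n$ be a polyhedral cone with normalized conic base $B_K=\{u^1,\ldots,u^p\}$ ($p\ge1$), so that $K=\operatorname{cone}(B_K)$, and let $d:=-P_{\operatorname{aff}(B_K)}(0)$ be its circumcentric direction. Suppose $d\ne 0$ and set $a:=-d/\|d\|\in S^{n-1}$ and $\theta(B_K):=\arccos\|d\|\in[0,\pi/2]$. Then $\langle u^i,a\rangle=\cos\theta(B_K)$ for every $i=1,\ldots,p$; that is, $B_K$ is contained in the relative boundary $\{u\in S^{n-1}:\langle u,a\rangle=\cos\theta(B_K)\}$ of the spherical cap $\{u\in S^{n-1}:\langle u,a\rangle\ge\cos\theta(B_K)\}$.
   Context: $\langle\cdot,\cdot\rangle$ and $\|\cdot\|$ are the Euclidean inner product and norm, and $S^{n-1}=\{x\in\mathbb{R}^n:\|x\|=1\}$. The normalized conic base $B_K=\{u^1,\ldots,u^p\}$ of a polyhedral cone $K$ is the finite set of unit vectors along the extreme rays of $K$. $\operatorname{aff}(B_K)$ is the affine hull and $P_{\operatorname{aff}(B_K)}(0)$ is the orthogonal projection of the origin onto it (this is the circumcenter of $B_K$). *)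

theory Defs
  imports "HOL-Analysis.Analysis"
begin

definition polyhedral_cone :: "'a::euclidean_space set \<Rightarrow> bool" where
  "polyhedral_cone K \<longleftrightarrow> polyhedron K \<and> convex_cone K"

definition ray :: "'a::real_vector \<Rightarrow> 'a set" where
  "ray v = {t *\<^sub>R v | t::real. t \<ge> 0}"

text \<open>A half-line that is a face of a cone starts at the origin, so the extreme rays are
  the faces of the form \<open>ray v\<close> with \<open>v \<noteq> 0\<close>.  A cone that contains a line has no
  extreme ray.\<close>

definition extreme_ray_of :: "'a::real_vector set \<Rightarrow> 'a set \<Rightarrow> bool" (infixr \<open>extreme'_ray'_of\<close> 50) where
  "R extreme_ray_of K \<longleftrightarrow> R face_of K \<and> (\<exists>v. v \<noteq> 0 \<and> R = ray v)"

definition normalized_conic_base :: "'a::real_normed_vector set \<Rightarrow> 'a set" where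
  "normalized_conic_base K = {u. norm u = 1 \<and> (\<exists>R. R extreme_ray_of K \<and> u \<in> R)}"

definition circumcentric_direction :: "'a::euclidean_space set \<Rightarrow> 'a" where
  "circumcentric_direction K = - closest_point (affine hull (normalized_conic_base K)) 0"

definition spherical_cap :: "'a::real_inner \<Rightarrow> real \<Rightarrow> 'a set" where
  "spherical_cap a \<theta> = {u \<in> sphere 0 1. u \<bullet> a \<ge> cos \<theta>}"

text \<open>The relative boundary of a cap is the bounding slice written out here; for degenerate
  radii (\<open>\<theta> = 0\<close> in dimension one) it need not be the topological boundary in the sphere.\<close>

definition spherical_cap_boundary :: "'a::real_inner \<Rightarrow> real \<Rightarrow> 'a set" where
  "spherical_cap_boundary a \<theta> = {u \<in> spherical_cap a \<theta>. u \<bullet> a = cos \<theta>}"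

lemma ray_self: "v \<in> ray v"
  unfolding ray_def by (auto intro!: exI[of _ 1])

lemma ray_scale:
  assumes "c > 0" shows "ray (c *\<^sub>R v) = ray v"
proof
  show "ray (c *\<^sub>R v) \<subseteq> ray v"
  proof
    fix x assume "x \<in> ray (c *\<^sub>R v)"
    then obtain t where "t \<ge> 0" "x = (t * c) *\<^sub>R v" by (auto simp: ray_def)
    with assms show "x \<in> ray v"
      unfolding ray_def by (intro CollectI exI[of _ "t * c"]) simp
  qed
  show "ray v \<subseteq> ray (c *\<^sub>R v)"
  proof
    fix x assume "x \<in> ray v"
    then obtain t where "t \<ge> 0" "x = (t / c) *\<^sub>R (c *\<^sub>R v)" using assms by (auto simp: ray_def)
    with assms show "x \<in> ray (c *\<^sub>R v)"
      unfolding ray_def by (intro CollectI exI[of _ "t / c"]) simp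
  qed
qed

lemma normalized_conic_base_iff:
  "u \<in> normalized_conic_base K \<longleftrightarrow> norm u = 1 \<and> ray u face_of K"
proof
  assume "u \<in> normalized_conic_base K"
  then obtain v t where u: "norm u = 1" and v: "ray v face_of K"
    and t: "t \<ge> 0" "u = t *\<^sub>R v"
    by (auto simp: normalized_conic_base_def extreme_ray_of_def ray_def)
  have "t > 0" using u t by (cases "t = 0") auto
  then have "ray u = ray v" unfolding t(2) by (rule ray_scale)
  then show "norm u = 1 \<and> ray u face_of K" using u v by simp
next
  assume u: "norm u = 1 \<and> ray u face_of K"
  then have "u \<noteq> 0" by auto
  with u have "ray u extreme_ray_of K" unfolding extreme_ray_of_def by blast
  with u show "u \<in> normalized_conic_base K"
    unfolding normalized_conic_base_def using ray_self by blast
qed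

lemma finite_normalized_conic_base:
  fixes K :: "'a::euclidean_space set"
  assumes "polyhedral_cone K"
  shows "finite (normalized_conic_base K)"
proof (rule inj_on_finite[where f = ray])
  show "inj_on ray (normalized_conic_base K)"
  proof (rule inj_onI)
    fix u v assume "u \<in> normalized_conic_base K" "v \<in> normalized_conic_base K" and r: "ray u = ray v"
    then have n: "norm u = 1" "norm v = 1" by (auto simp: normalized_conic_base_iff)
    have "u \<in> ray v" using ray_self[of u] by (simp only: r)
    then obtain t where "t \<ge> 0" "u = t *\<^sub>R v" by (auto simp: ray_def)
    with n show "u = v" by simp
  qed
  show "ray ` normalized_conic_base K \<subseteq> {F. F face_of K}"
    by (auto simp: normalized_conic_base_iff)
  show "finite {F. F face_of K}"
    using assms finite_polyhedron_faces by (auto simp: polyhedral_cone_def)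
qed

text \<open>Once there is an extreme ray, the cone is pointed and hence generated by its
  normalized conic base.\<close>

lemma polyhedral_cone_eq_hull_base:
  fixes K :: "'a::euclidean_space set"
  assumes K: "polyhedral_cone K" and ne: "normalized_conic_base K \<noteq> {}"
  shows "K = convex_cone hull (normalized_conic_base K)"
proof -
  let ?B = "normalized_conic_base K"
  have poly: "polyhedron K" and cc: "convex_cone K"
    using K by (auto simp: polyhedral_cone_def)
  have scale: "c *\<^sub>R x \<in> K" if "x \<in> K" "c \<ge> 0" for c x
    using convex_cone_scaleR cc that by blast
  have zK: "0 \<in> K" using convex_cone_iff cc by blast
  obtain u where u: "norm u = 1" "ray u face_of K"
    using ne normalized_conic_base_iff by blast
  have "{0} face_of ray u"
  proof -
    have "a = 0 \<and> b = 0"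
      if seg: "0 \<in> open_segment a b" and ab: "a \<in> ray u" "b \<in> ray u" for a b
    proof -
      obtain s t where st: "s \<ge> 0" "t \<ge> 0" "a = s *\<^sub>R u" "b = t *\<^sub>R u"
        using ab by (auto simp: ray_def)
      obtain r where r: "0 < r" "r < 1" "0 = (1 - r) *\<^sub>R a + r *\<^sub>R b"
        using seg by (auto simp: in_segment)
      then have "((1 - r) * s + r * t) *\<^sub>R u = 0"
        using st by (simp add: algebra_simps)
      then have "(1 - r) * s + r * t = 0" using u by auto
      then have "s = 0 \<and> t = 0"
        using r st by (simp add: add_nonneg_eq_0_iff)
      then show ?thesis using st by simp
    qed
    moreover have "0 \<in> ray u" by (auto simp: ray_def intro!: exI[of _ 0])
    ultimately show ?thesis by (auto simp: face_of_def)
  qed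
  then have "{0} face_of K" using u face_of_trans by blast
  then have "{0} exposed_face_of K"
    using poly exposed_face_of_polyhedron by blast
  then obtain a b where ab: "K \<subseteq> {x. a \<bullet> x \<le> b}" "{0} = K \<inter> {x. a \<bullet> x = b}"
    unfolding exposed_face_of_def by blast
  then have "0 \<in> {x. a \<bullet> x = b}" by blast
  then have "b = 0" by simp
  with ab have "K \<subseteq> {x. a \<bullet> x \<le> 0}" "{0} = K \<inter> {x. a \<bullet> x = 0}" by auto
  then have neg: "a \<bullet> x < 0" if "x \<in> K" "x \<noteq> 0" for x
  proof -
    have "a \<bullet> x \<le> 0" using that \<open>K \<subseteq> {x. a \<bullet> x \<le> 0}\<close> by blast
    moreover have "a \<bullet> x \<noteq> 0"
    proof
      assume "a \<bullet> x = 0"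
      then have "x \<in> K \<inter> {x. a \<bullet> x = 0}" using that by blast
      then show False using \<open>{0} = K \<inter> {x. a \<bullet> x = 0}\<close> that by blast
    qed
    ultimately show ?thesis by simp
  qed
  define c where "c = - a"
  have pos: "c \<bullet> x > 0" if "x \<in> K" "x \<noteq> 0" for x
    using neg[OF that] by (simp add: c_def)
  have nonneg: "c \<bullet> x \<ge> 0" if "x \<in> K" for x
    using pos[OF that] by (cases "x = 0") auto
  define C where "C = K \<inter> {x. c \<bullet> x = 1}"
  have uK: "u \<in> K" using u ray_self face_of_imp_subset by blast
  have "compact (K \<inter> sphere 0 1)"
    using polyhedron_imp_closed[OF poly] by (simp add: closed_Int_compact)
  moreover have "K \<inter> sphere 0 1 \<noteq> {}" using u uK by auto
  moreover have "continuous_on (K \<inter> sphere 0 1) (\<lambda>x. c \<bullet> x)"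
    by (intro continuous_intros)
  ultimately obtain w where w: "w \<in> K \<inter> sphere 0 1"
    and wmin: "\<forall>y \<in> K \<inter> sphere 0 1. c \<bullet> w \<le> c \<bullet> y"
    using continuous_attains_inf by blast
  define m where "m = c \<bullet> w"
  have m: "m > 0"
  proof -
    have "w \<noteq> 0" using w by auto
    then show ?thesis using pos[of w] w by (simp add: m_def)
  qed
  have norm_le: "m * norm x \<le> c \<bullet> x" if "x \<in> K" for x
  proof (cases "x = 0")
    case False
    have "(1 / norm x) *\<^sub>R x \<in> K \<inter> sphere 0 1" using that scale False by simp
    then have "m \<le> c \<bullet> ((1 / norm x) *\<^sub>R x)" using wmin m_def by blast
    then show ?thesis using False by (simp add: field_simps)
  qed simp
  have "C \<subseteq> cball 0 (1 / m)"
  proof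
    fix x assume "x \<in> C"
    then have "m * norm x \<le> 1" using norm_le[of x] by (auto simp: C_def)
    then show "x \<in> cball 0 (1 / m)" using m by (simp add: field_simps)
  qed
  then have "bounded C" using bounded_cball bounded_subset by blast
  moreover have "polyhedron C" unfolding C_def using poly polyhedron_hyperplane by blast
  ultimately have KM: "C = convex hull {x. x extreme_point_of C}"
    by (intro Krein_Milman_Minkowski)
      (simp_all add: compact_eq_bounded_closed polyhedron_imp_closed polyhedron_imp_convex)
  have ext: "ray v face_of K" if v: "v extreme_point_of C" for v
    unfolding face_of_def
  proof (intro conjI ballI impI)
    have vK: "v \<in> K" and cv: "c \<bullet> v = 1"
      using v by (auto simp: extreme_point_of_def C_def)
    show "ray v \<subseteq> K" using vK scale by (auto simp: ray_def)
    have "ray v = (\<lambda>t. t *\<^sub>R v) ` {0..}" by (auto simp: ray_def)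
    then show "convex (ray v)" by (auto intro!: convex_linear_image bounded_linear.linear bounded_linear_scaleR_left)
    fix x y z assume xy: "x \<in> K" "y \<in> K" and z: "z \<in> ray v" "z \<in> open_segment x y"
    obtain t where t: "t \<ge> 0" "z = t *\<^sub>R v" using z by (auto simp: ray_def)
    obtain s where s: "0 < s" "s < 1" "z = (1 - s) *\<^sub>R x + s *\<^sub>R y"
      using z by (auto simp: in_segment)
    define \<alpha> \<beta> where "\<alpha> = c \<bullet> x" and "\<beta> = c \<bullet> y"
    have ab: "\<alpha> \<ge> 0" "\<beta> \<ge> 0" using nonneg xy by (auto simp: \<alpha>_def \<beta>_def)
    have "c \<bullet> z = t" using t cv by simp
    then have tt: "t = (1 - s) * \<alpha> + s * \<beta>"
      using s by (simp add: \<alpha>_def \<beta>_def inner_add_right)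
    have inray: "q *\<^sub>R v \<in> ray v" if "q \<ge> 0" for q using that by (auto simp: ray_def)
    have "x \<in> ray v \<and> y \<in> ray v"
    proof (cases "\<alpha> = 0 \<or> \<beta> = 0")
      case True
      then consider "x = 0" | "y = 0"
        using pos[OF xy(1)] pos[OF xy(2)] unfolding \<alpha>_def \<beta>_def by fastforce
      then show ?thesis
      proof cases
        case 1
        then have "s *\<^sub>R y = t *\<^sub>R v" using s t by simp
        then have "(1 / s) *\<^sub>R (s *\<^sub>R y) = (1 / s) *\<^sub>R (t *\<^sub>R v)" by simp
        then have "y = (t / s) *\<^sub>R v" using s by simp
        then show ?thesis using 1 inray[of 0] inray[of "t / s"] s t by simp
      next
        case 2
        then have "(1 - s) *\<^sub>R x = t *\<^sub>R v" using s t by simp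
        then have "(1 / (1 - s)) *\<^sub>R ((1 - s) *\<^sub>R x) = (1 / (1 - s)) *\<^sub>R (t *\<^sub>R v)" by simp
        then have "x = (t / (1 - s)) *\<^sub>R v" using s by simp
        then show ?thesis using 2 inray[of 0] inray[of "t / (1 - s)"] s t by simp
      qed
    next
      case False
      then have p: "\<alpha> > 0" "\<beta> > 0" using ab by auto
      then have tp: "t > 0" using s by (simp add: tt add_pos_pos)
      let ?x = "(1 / \<alpha>) *\<^sub>R x" and ?y = "(1 / \<beta>) *\<^sub>R y"
      have C: "?x \<in> C" "?y \<in> C"
        using p xy scale by (auto simp: C_def \<alpha>_def \<beta>_def)
      define r where "r = s * \<beta> / t"
      have r1: "1 - r = (1 - s) * \<alpha> / t" using tt tp by (simp add: r_def field_simps)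
      have r: "0 < r" "0 < 1 - r" using s p tp by (simp add: r_def, simp add: r1)
      have "(1 - r) *\<^sub>R ?x + r *\<^sub>R ?y = (1 / t) *\<^sub>R ((1 - s) *\<^sub>R x + s *\<^sub>R y)"
        unfolding r1 using p by (simp add: r_def scaleR_add_right)
      also have "\<dots> = v" unfolding s(3)[symmetric] t(2) using tp by simp
      finally have v_eq: "v = (1 - r) *\<^sub>R ?x + r *\<^sub>R ?y" by simp
      have "?x = ?y"
      proof (rule ccontr)
        assume "?x \<noteq> ?y"
        then have "v \<in> open_segment ?x ?y" using v_eq r by (auto simp: in_segment)
        then show False using v C by (auto simp: extreme_point_of_def)
      qed
      moreover have "(1 - r) *\<^sub>R ?y + r *\<^sub>R ?y = ?y"
        unfolding scaleR_add_left[symmetric] by simp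
      ultimately have "v = ?y" "v = ?x" using v_eq by metis+
      then have "\<alpha> *\<^sub>R v = \<alpha> *\<^sub>R ?x" "\<beta> *\<^sub>R v = \<beta> *\<^sub>R ?y" by metis+
      then have "x = \<alpha> *\<^sub>R v" "y = \<beta> *\<^sub>R v" using p by simp_all
      then show ?thesis using inray p by simp
    qed
    then show "x \<in> ray v" "y \<in> ray v" by auto
  qed
  have hull: "convex_cone (convex_cone hull ?B)" by (rule convex_cone_convex_cone_hull)
  have "v \<in> convex_cone hull ?B" if v: "v extreme_point_of C" for v
  proof -
    have v0: "v \<noteq> 0" using v by (auto simp: extreme_point_of_def C_def)
    then have "(1 / norm v) *\<^sub>R v \<in> ?B"
      using ext[OF v] ray_scale[of "1 / norm v" v] by (simp add: normalized_conic_base_iff)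
    then have "norm v *\<^sub>R ((1 / norm v) *\<^sub>R v) \<in> convex_cone hull ?B"
      by (intro convex_cone_scaleR[OF hull norm_ge_zero] hull_inc)
    then show ?thesis using v0 by simp
  qed
  then have "{x. x extreme_point_of C} \<subseteq> convex_cone hull ?B" by blast
  moreover have "convex (convex_cone hull ?B)" using hull unfolding convex_cone_def by simp
  ultimately have "convex hull {x. x extreme_point_of C} \<subseteq> convex_cone hull ?B"
    by (rule hull_minimal)
  then have CB: "C \<subseteq> convex_cone hull ?B" using KM by simp
  show ?thesis
  proof (rule subset_antisym)
    show "K \<subseteq> convex_cone hull ?B"
    proof
      fix x assume x: "x \<in> K"
      show "x \<in> convex_cone hull ?B"
      proof (cases "x = 0")
        case True
        then show ?thesis using hull unfolding convex_cone_iff by simp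
      next
        case False
        note p = pos[OF x False]
        have "(1 / (c \<bullet> x)) *\<^sub>R x \<in> C" using p x scale by (simp add: C_def)
        then have "(1 / (c \<bullet> x)) *\<^sub>R x \<in> convex_cone hull ?B" using CB by (rule rev_subsetD)
        then have "(c \<bullet> x) *\<^sub>R ((1 / (c \<bullet> x)) *\<^sub>R x) \<in> convex_cone hull ?B"
          by (rule convex_cone_scaleR[OF hull less_imp_le[OF p]])
        then show ?thesis using p by simp
      qed
    qed
    have "?B \<subseteq> K"
    proof
      fix v assume "v \<in> ?B"
      then have "ray v face_of K" by (simp add: normalized_conic_base_iff)
      then show "v \<in> K" using face_of_imp_subset ray_self by blast
    qed
    then show "convex_cone hull ?B \<subseteq> K" using cc by (rule hull_minimal)
  qed
qed

end

theory Submission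
  imports Defs
begin

text \<open>Let \<open>c\<close> be the projection of the origin onto the affine hull of the base,
  so \<open>d = - c\<close> and \<open>a\<close> is \<open>c\<close> normalized. Since
  \<open>c\<close> is orthogonal to \<open>v - c\<close> for each base vector \<open>v\<close>
  (\<open>inner_closest_point_affine\<close>), all base vectors have the same inner product
  \<open>norm c ^ 2\<close> with \<open>c\<close>. Dividing by \<open>norm c\<close> gives
  \<open>norm c\<close>, which is the cosine of \<open>arccos (norm d)\<close>. That
  \<open>K\<close> is generated by its base is \<open>polyhedral_cone_eq_hull_base\<close>.\<close>

lemma inner_closest_point_affine:
  fixes S :: "'a::euclidean_space set"
  assumes "affine S" and "x \<in> S"
  shows "(y - closest_point S y) \<bullet> (x - closest_point S y) = 0"
proof -
  let ?c = "closest_point S y"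
  have closed: "closed S" and convex: "convex S"
    using assms(1) by (simp_all add: affine_closed affine_imp_convex)
  have c: "?c \<in> S"
    using closed assms(2) by (auto intro: closest_point_in_set)
  \<comment> \<open>The obtuse-angle inequality, applied to the reflection of \<open>x\<close> in the closest point.\<close>
  have "2 *\<^sub>R ?c + (-1) *\<^sub>R x \<in> S"
    by (rule mem_affine[OF assms(1) c assms(2)]) simp
  then have "(y - ?c) \<bullet> ((2 *\<^sub>R ?c + (-1) *\<^sub>R x) - ?c) \<le> 0"
    by (rule closest_point_dot[OF convex closed])
  moreover have "(2 *\<^sub>R ?c + (-1) *\<^sub>R x) - ?c = - (x - ?c)"
    by (simp add: scaleR_2)
  ultimately have "(y - ?c) \<bullet> (x - ?c) \<ge> 0"
    by (simp only: inner_minus_right neg_le_0_iff_le)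
  with closest_point_dot[OF convex closed assms(2), of y] show ?thesis
    by simp
qed

theorem proposition5p1:
  fixes K :: "(real ^ 'n) set" and u :: "nat \<Rightarrow> real ^ 'n" and p :: nat
    and d a :: "real ^ 'n" and \<theta> :: real
  assumes "polyhedral_cone K"
    and "p \<ge> 1"
    and "normalized_conic_base K = u ` {1..p}"
    and "d = circumcentric_direction K"
    and "d \<noteq> 0"
    and "a = - (d /\<^sub>R norm d)"
    and "\<theta> = arccos (norm d)"
  shows "K = convex_cone hull (normalized_conic_base K)
    \<and> a \<in> sphere 0 1
    \<and> \<theta> \<in> {0..pi/2}
    \<and> (\<forall>i\<in>{1..p}. u i \<bullet> a = cos \<theta>)
    \<and> normalized_conic_base K \<subseteq> spherical_cap_boundary a \<theta>"
proof -
  let ?B = "normalized_conic_base K"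
  define c where "c = closest_point (affine hull ?B) 0"
  have d: "d = - c"
    using assms(4) by (simp add: c_def circumcentric_direction_def)
  have c0: "norm c > 0"
    using assms(5) d by simp
  \<comment> \<open>An extreme ray makes \<open>K\<close> pointed, which the generation of
    \<open>K\<close> by its base rests on; it also supplies a unit vector to compare with
    \<open>c\<close>.\<close>
  have "?B \<noteq> {}"
    using assms(2,3) by simp
  have unit: "norm v = 1" if "v \<in> ?B" for v
    using that by (simp add: normalized_conic_base_iff)
  \<comment> \<open>Orthogonality with \<open>y = 0\<close> reads
    \<open>(- c) \<bullet> (v - c) = 0\<close>.\<close>
  have inner_c: "v \<bullet> c = norm c ^ 2" if "v \<in> ?B" for v
    using inner_closest_point_affine[OF affine_affine_hull hull_inc[OF that], of 0]
    by (simp add: c_def[symmetric] inner_diff_right power2_norm_eq_inner inner_commute)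
  \<comment> \<open>No point of the affine hull, in particular no unit base vector, is nearer to the
    origin than \<open>c\<close>. This bound puts \<open>norm c\<close> in the range where
    \<open>cos\<close> inverts \<open>arccos\<close>.\<close>
  have c1: "norm c \<le> 1"
  proof -
    obtain v where v: "v \<in> ?B"
      using \<open>?B \<noteq> {}\<close> by blast
    have "dist 0 c \<le> dist 0 v"
      unfolding c_def by (rule closest_point_le[OF closed_affine_hull hull_inc[OF v]])
    then show ?thesis
      using unit[OF v] by simp
  qed
  have a: "a = c /\<^sub>R norm c"
    using assms(6) d by simp
  have \<theta>: "\<theta> = arccos (norm c)"
    using assms(7) d by simp
  have cos: "cos \<theta> = norm c"
    using c1 by (simp add: \<theta> cos_arccos_abs)
  have inner_a: "v \<bullet> a = cos \<theta>" if "v \<in> ?B" for v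
    using inner_c[OF that] c0 by (simp add: a cos field_simps power2_eq_square)
  have "K = convex_cone hull ?B"
    using assms(1) \<open>?B \<noteq> {}\<close> by (rule polyhedral_cone_eq_hull_base)
  moreover have "a \<in> sphere 0 1"
    using c0 by (simp add: a)
  \<comment> \<open>The upper bound \<open>pi/2\<close> comes from \<open>norm c \<ge> 0\<close>;
    the lower bound \<open>0\<close> needs \<open>norm c\<close> between \<open>- 1\<close> and
    \<open>1\<close>.\<close>
  moreover have "\<theta> \<in> {0..pi/2}"
    using c1 order_trans[OF _ norm_ge_zero, of "- 1" c] arccos_le_pi2[of "norm c"]
    by (simp add: \<theta> arccos_lbound)
  moreover have "\<forall>i\<in>{1..p}. u i \<bullet> a = cos \<theta>"
    using inner_a assms(3) by blast
  moreover have "?B \<subseteq> spherical_cap_boundary a \<theta>"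
    using inner_a unit by (auto simp: spherical_cap_boundary_def spherical_cap_def)
  ultimately show ?thesis
    by blast
qed

end
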